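(* Let $\mathcal{F}$ be the family of split-state adversaries acting on $n$ bits: each $f\in\mathcal{F}$ interprets its input as a pair $(x_1,x_2)$ with $x_1\in\{0,1\}^{\lfloor n/2\rfloor}$ and $x_2\in\{0,1\}^{\lceil n/2\rceil}$, and outputs $(f_1(x_1),f_2(x_2))$ for arbitrary functions $f_1\colon\{0,1\}^{\lfloor n/2\rfloor}\to\{0,1\}^{\lfloor n/2\rfloor}$ and $f_2\colon\{0,1\}^{\lceil n/2\rceil}\to\{0,1\}^{\lceil n/2\rceil}$. For a fixed constant $\delta\in(0,1)$, let $\mathcal{F}_\delta$ be the class of functions $f\colon\{0,1\}^n\to\{0,1\}^n$ such that every bit of $f(x)$ depends on at most $\lfloor\delta n\rfloor$ of the bits of $x$. For every fixed constant $\gamma>0$ there is a fixed constant $\epsilon_0>0$ (which may depend on $\gamma$ and $\delta$) such that for all sufficiently large $n$ the following hold for every $\epsilon\le\epsilon_0$: (i) any coding scheme with block length $n$ that is non-malleable for $\mathcal{F}$ with error at most $\epsilon$ has rate $R\le 1/2+\gamma$; (ii) any coding scheme with block length $n$ that is non-malleable for $\mathcal{F}_\delta$ with error at most $\epsilon$ has rate $R_\delta\le 1-\delta+\gamma$.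
   Context: Coding scheme. A coding scheme with block length $n$ and message length $k\le n$ is a pair $\mathsf{Enc}\colon \{0,1\}^k \to \{0,1\}^n$, $\mathsf{Dec}\colon \{0,1\}^n \to \{0,1\}^k \cup \{\perp\}$, where $\mathsf{Enc}$ is randomized (using uniform internal coin flips), $\mathsf{Dec}$ is deterministic, and $\mathsf{Dec}(\mathsf{Enc}(s)) = s$ with probability $1$ for every $s\in\{0,1\}^k$. Its rate is $k/n$. Non-malleability. For a special symbol $\mathsf{same}$, let $\mathrm{copy}(x,y) := x$ if $x\ne\mathsf{same}$ and $\mathrm{copy}(\mathsf{same},y) := y$. A coding scheme is non-malleable with error $\epsilon$ with respect to a family $\mathcal{F}$ of functions $\{0,1\}^n\to\{0,1\}^n$ if for every $f\in\mathcal{F}$ there is a distribution $\mathcal{D}_f$ over $\{0,1\}^k\cup\{\perp,\mathsf{same}\}$ such that for every $s\in\{0,1\}^k$, the distribution of $\mathsf{Dec}(f(\mathsf{Enc}(s)))$ is within statistical (total variation) distance $\epsilon$ of the distribution of $\mathrm{copy}(S',s)$, where $S'\sim\mathcal{D}_f$. *)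

theory Defs
  imports "HOL-Probability.Probability_Mass_Function"
begin

definition bits :: "nat \<Rightarrow> bool list set" where
  "bits n = {x. length x = n}"

lemma finite_bits [simp]: "finite (bits n)"
  using finite_lists_length_eq[of "UNIV :: bool set" n] by (simp add: bits_def)

lemma bits_not_empty [simp]: "bits n \<noteq> {}"
  by (auto simp: bits_def intro: exI[of _ "replicate n False"])

definition tv_dist :: "'a pmf \<Rightarrow> 'a pmf \<Rightarrow> real" where
  "tv_dist p q = (SUP A. \<bar>measure_pmf.prob p A - measure_pmf.prob q A\<bar>)"

(* The encoder takes the message and its internal coin flips, a uniformly random string of
   r bits.  The decoder returns None for the error symbol. *)
definition encode :: "nat \<Rightarrow> (bool list \<Rightarrow> bool list \<Rightarrow> bool list) \<Rightarrow> bool list \<Rightarrow> bool list pmf" where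
  "encode r Enc s = map_pmf (Enc s) (pmf_of_set (bits r))"

definition coding_scheme ::
  "nat \<Rightarrow> nat \<Rightarrow> nat \<Rightarrow> (bool list \<Rightarrow> bool list \<Rightarrow> bool list) \<Rightarrow> (bool list \<Rightarrow> bool list option) \<Rightarrow> bool" where
  "coding_scheme n k r Enc Dec \<longleftrightarrow>
     k \<le> n \<and>
     Enc \<in> bits k \<rightarrow> bits r \<rightarrow> bits n \<and>
     Dec \<in> bits n \<rightarrow> insert None (Some ` bits k) \<and>
     (\<forall>s\<in>bits k. measure_pmf.prob (encode r Enc s) {x. Dec x = Some s} = 1)"

definition rate :: "nat \<Rightarrow> nat \<Rightarrow> real" where
  "rate n k = real k / real n"

datatype outcome = Same | Outcome "bool list option"

fun copy :: "outcome \<Rightarrow> bool list \<Rightarrow> bool list option" where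
  "copy Same s = Some s"
| "copy (Outcome v) s = v"

definition outcomes :: "nat \<Rightarrow> outcome set" where
  "outcomes k = insert Same (Outcome ` insert None (Some ` bits k))"

definition non_malleable ::
  "nat \<Rightarrow> nat \<Rightarrow> (bool list \<Rightarrow> bool list \<Rightarrow> bool list) \<Rightarrow> (bool list \<Rightarrow> bool list option) \<Rightarrow>
   (bool list \<Rightarrow> bool list) set \<Rightarrow> real \<Rightarrow> bool" where
  "non_malleable k r Enc Dec F \<epsilon> \<longleftrightarrow>
     (\<forall>f\<in>F. \<exists>D :: outcome pmf. set_pmf D \<subseteq> outcomes k \<and>
        (\<forall>s\<in>bits k. tv_dist (map_pmf (\<lambda>x. Dec (f x)) (encode r Enc s))
                             (map_pmf (\<lambda>S'. copy S' s) D) \<le> \<epsilon>))"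

(* Tampering functions are constrained only on bits n, the codewords of block length n. *)
definition split_state :: "nat \<Rightarrow> (bool list \<Rightarrow> bool list) set" where
  "split_state n =
     {f. \<exists>f1 \<in> bits (n div 2) \<rightarrow> bits (n div 2).
         \<exists>f2 \<in> bits (n - n div 2) \<rightarrow> bits (n - n div 2).
         \<forall>x\<in>bits n. f x = f1 (take (n div 2) x) @ f2 (drop (n div 2) x)}"

definition depends_only_on :: "nat \<Rightarrow> (bool list \<Rightarrow> bool) \<Rightarrow> nat set \<Rightarrow> bool" where
  "depends_only_on n g J \<longleftrightarrow>
     (\<forall>x\<in>bits n. \<forall>y\<in>bits n. (\<forall>j\<in>J. x ! j = y ! j) \<longrightarrow> g x = g y)"

definition local_tampering :: "real \<Rightarrow> nat \<Rightarrow> (bool list \<Rightarrow> bool list) set" where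
  "local_tampering \<delta> n =
     {f \<in> bits n \<rightarrow> bits n.
        \<forall>i<n. \<exists>J\<subseteq>{..<n}. int (card J) \<le> \<lfloor>\<delta> * real n\<rfloor> \<and> depends_only_on n (\<lambda>x. f x ! i) J}"

end

theory Submission
  imports Defs
begin

text \<open>
  Fix a prefix length m. A prefix u of length m extends to codewords of at most 2^(n-m) messages, so
  if k exceeds n-m by a constant, averaging over the messages yields s1 such that the prefixes
  extendable to a codeword of s1 are unlikely in an encoding of a given s0, although they carry every
  encoding of s1. Tampering that writes a fixed word c on these prefixes and c' on all others, with
  Dec c and Dec c' distinct and Dec c distinct from s1, forces the simulating distribution to output
  Dec c for s1 and hence also for s0, where Dec c is in fact rare. A local adversary can
  read the first \<open>\<lfloor>\<delta> n\<rfloor>\<close> bits. A split-state adversary reads the left half and must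
  choose c and c' with the same right half; this is possible, since otherwise Dec would only depend
  on the right half, which is shorter than the message.
\<close>

lemma card_bits: "card (bits n) = 2 ^ n"
  using card_lists_length_eq[of "UNIV :: bool set" n] by (simp add: bits_def)

text \<open>The supremum in \<open>tv_dist\<close> is taken in the reals, so it dominates a single
  event only because all differences are bounded by 1.\<close>

lemma abs_prob_diff_le_tv_dist:
  "\<bar>measure_pmf.prob p A - measure_pmf.prob q A\<bar> \<le> tv_dist p q"
  unfolding tv_dist_def
proof (rule cSUP_upper)
  have "\<bar>measure_pmf.prob p B - measure_pmf.prob q B\<bar> \<le> 1" for B
    using measure_pmf.prob_le_1[of p B] measure_pmf.prob_le_1[of q B]
      measure_nonneg[of "measure_pmf p" B] measure_nonneg[of "measure_pmf q" B]
    by linarith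
  then show "bdd_above (range (\<lambda>A. \<bar>measure_pmf.prob p A - measure_pmf.prob q A\<bar>))"
    by (auto intro!: bdd_aboveI[of _ 1])
qed simp

lemma encode_supportD:
  assumes "coding_scheme n k r Enc Dec" "s \<in> bits k" "x \<in> set_pmf (encode r Enc s)"
  shows "x \<in> bits n" "Dec x = Some s"
proof -
  show "x \<in> bits n"
    using assms by (auto simp: coding_scheme_def encode_def Pi_iff)
  have "measure_pmf.prob (encode r Enc s) {x. Dec x = Some s} = 1"
    using assms by (auto simp: coding_scheme_def)
  then have "AE x in measure_pmf (encode r Enc s). Dec x = Some s"
    using measure_pmf.prob_eq_1[of "{x. Dec x = Some s}" "encode r Enc s"] by simp
  then show "Dec x = Some s"
    using assms(3) by (simp add: AE_measure_pmf_iff)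
qed

lemma finite_set_pmf_encode: "finite (set_pmf (encode r Enc s))"
  by (simp add: encode_def)

lemma codeword_exists:
  assumes "coding_scheme n k r Enc Dec" "s \<in> bits k"
  obtains x where "x \<in> bits n" "Dec x = Some s"
  using encode_supportD[OF assms] set_pmf_not_empty[of "encode r Enc s"] by blast

text \<open>Linearity of expectation for indicators. It reduces an average over messages to a count
  of messages for each fixed codeword.\<close>

lemma sum_prob_eq_expectation_card:
  assumes "finite S" "finite (set_pmf p)"
  shows "(\<Sum>s\<in>S. measure_pmf.prob p {x. P s x}) =
    measure_pmf.expectation p (\<lambda>x. real (card {s\<in>S. P s x}))"
proof -
  have "(\<Sum>s\<in>S. measure_pmf.prob p {x. P s x}) =
      (\<Sum>s\<in>S. measure_pmf.expectation p (indicator {x. P s x}))"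
    by simp
  also have "\<dots> = measure_pmf.expectation p (\<lambda>x. \<Sum>s\<in>S. indicator {x. P s x} x)"
    by (rule Bochner_Integration.integral_sum[symmetric])
      (rule integrable_measure_pmf_finite[OF assms(2)])
  also have "(\<lambda>x. \<Sum>s\<in>S. indicator {x. P s x} x) = (\<lambda>x. real (card {s\<in>S. P s x}))"
    using assms(1) by (auto simp: indicator_def sum.If_cases Int_def)
  finally show ?thesis .
qed

text \<open>Averaging over the messages gives \<open>s1\<close>. The excluded value \<open>v\<close>
  will be the decoding of a tampered word, which must not coincide with \<open>s1\<close>.\<close>

lemma distinguishing_prefixes:
  assumes cs: "coding_scheme n k r Enc Dec" and "m \<le> n" and k: "n - m + 3 \<le> k"
  obtains s1 T where "s1 \<in> bits k" "Some s1 \<noteq> v"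
    "measure_pmf.prob (encode r Enc s0) {x. take m x \<in> T} \<le> 1 / 4"
    "\<And>x. x \<in> set_pmf (encode r Enc s1) \<Longrightarrow> take m x \<in> T"
proof -
  define p where "p = encode r Enc s0"
  \<comment> \<open>All words decoding to \<open>s\<close> count here, not only encoder outputs:
    \<open>Dec\<close> is a function, so each suffix \<open>y\<close> puts a given \<open>u\<close>
    into at most one \<open>T s\<close>.\<close>
  define T where "T s = {u. \<exists>y\<in>bits (n - m). Dec (u @ y) = Some s}" for s
  define S where "S = {s \<in> bits k. Some s \<noteq> v}"
  have finS: "finite S"
    by (simp add: S_def)
  \<comment> \<open>Excluding \<open>v\<close> costs at most one message. For
    \<open>v = None\<close> the value \<open>the v\<close> is arbitrary, but then \<open>S\<close>
    is all of \<open>bits k\<close>.\<close>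
  have "bits k \<subseteq> insert (the v) S"
    by (auto simp: S_def)
  then have "card (bits k) \<le> card (insert (the v) S)"
    by (intro card_mono) (simp_all add: finS)
  also have "\<dots> \<le> Suc (card S)"
    by (rule card_insert_le_m1) (auto simp: finS)
  finally have "(2::nat) ^ k \<le> Suc (card S)"
    by (simp add: card_bits)
  \<comment> \<open>With \<open>N = 2 ^ (n - m)\<close>, three surplus bits leave at least
    \<open>8 * N - 1\<close>, hence \<open>4 * N\<close> messages; the factor 4 becomes the
    probability 1/4.\<close>
  moreover have "(2::nat) ^ (n - m + 3) \<le> 2 ^ k"
    using k by (intro power_increasing) auto
  moreover have "(1::nat) \<le> 2 ^ (n - m)"
    by simp
  ultimately have cardS: "4 * 2 ^ (n - m) \<le> card S"
    unfolding power_add by simp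
  have "card {s \<in> S. u \<in> T s} \<le> 2 ^ (n - m)" for u
  proof -
    have "{s \<in> S. u \<in> T s} \<subseteq> (\<lambda>y. the (Dec (u @ y))) ` bits (n - m)"
      by (force simp: T_def)
    then have "card {s \<in> S. u \<in> T s} \<le> card (bits (n - m))"
      by (intro surj_card_le) auto
    then show ?thesis
      by (simp add: card_bits)
  qed
  then have "measure_pmf.expectation p (\<lambda>x. real (card {s \<in> S. take m x \<in> T s}))
      \<le> measure_pmf.expectation p (\<lambda>x. 2 ^ (n - m))"
    using of_nat_mono[where 'a = real]
    by (intro integral_mono integrable_measure_pmf_finite) (fastforce simp: p_def finite_set_pmf_encode)+
  then have sum_le: "(\<Sum>s\<in>S. measure_pmf.prob p {x. take m x \<in> T s}) \<le> 2 ^ (n - m)"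
    by (subst sum_prob_eq_expectation_card) (auto simp: finS p_def finite_set_pmf_encode)
  have "\<exists>s\<in>S. measure_pmf.prob p {x. take m x \<in> T s} \<le> 1 / 4"
  proof (rule ccontr)
    assume "\<not> ?thesis"
    moreover have "S \<noteq> {}"
      using cardS by auto
    ultimately have "(\<Sum>s\<in>S. 1 / 4) < (\<Sum>s\<in>S. measure_pmf.prob p {x. take m x \<in> T s})"
      using finS by (intro sum_strict_mono) (auto simp: not_le)
    moreover have "real (4 * 2 ^ (n - m)) \<le> real (card S)"
      using cardS by (rule of_nat_mono)
    ultimately show False
      using sum_le by simp
  qed
  then obtain s1 where s1: "s1 \<in> S" "measure_pmf.prob p {x. take m x \<in> T s1} \<le> 1 / 4"
    by blast
  show thesis
  proof
    show "s1 \<in> bits k" "Some s1 \<noteq> v"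
      using s1(1) by (auto simp: S_def)
    show "measure_pmf.prob (encode r Enc s0) {x. take m x \<in> T s1} \<le> 1 / 4"
      using s1(2) by (simp add: p_def)
    fix x assume "x \<in> set_pmf (encode r Enc s1)"
    then have "x \<in> bits n" "Dec x = Some s1"
      using encode_supportD[OF cs \<open>s1 \<in> bits k\<close>] by auto
    then show "take m x \<in> T s1"
      unfolding T_def mem_Collect_eq by (intro bexI[of _ "drop m x"]) (auto simp: bits_def)
  qed
qed

text \<open>The event that the tampered word decodes to \<open>Dec c\<close> has probability 1 for
  \<open>s1\<close> and at most 1/4 for \<open>s0\<close>, while the simulator gives it no more
  weight for \<open>s1\<close> than for \<open>s0\<close>. Hence 1 - \<epsilon> \<le> 1/4 +
  \<epsilon>, which fails for \<epsilon> \<le> 1/4.\<close>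

lemma not_non_malleable_prefix_tampering:
  assumes cs: "coding_scheme n k r Enc Dec" and "m \<le> n" and "n - m + 3 \<le> k"
    and ne: "Dec c \<noteq> Dec c'"
    and F: "\<And>T. (\<lambda>x. if take m x \<in> T then c else c') \<in> F"
    and "\<epsilon> \<le> 1 / 4"
  shows "\<not> non_malleable k r Enc Dec F \<epsilon>"
proof
  assume nm: "non_malleable k r Enc Dec F \<epsilon>"
  obtain s0 where s0: "s0 \<in> bits k"
    using bits_not_empty by blast
  obtain s1 T where s1: "s1 \<in> bits k" "Some s1 \<noteq> Dec c"
    and p0: "measure_pmf.prob (encode r Enc s0) {x. take m x \<in> T} \<le> 1 / 4"
    and p1: "\<And>x. x \<in> set_pmf (encode r Enc s1) \<Longrightarrow> take m x \<in> T"
    using distinguishing_prefixes[OF assms(1-3), of "Dec c" s0] by metis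
  define f where "f x = (if take m x \<in> T then c else c')" for x
  have "f \<in> F"
    using F[of T] by (simp add: f_def[abs_def])
  then obtain D where D: "\<And>s. s \<in> bits k \<Longrightarrow>
      tv_dist (map_pmf (\<lambda>x. Dec (f x)) (encode r Enc s)) (map_pmf (\<lambda>S'. copy S' s) D) \<le> \<epsilon>"
    using nm unfolding non_malleable_def by blast
  have close: "\<bar>measure_pmf.prob (encode r Enc s) {x. Dec (f x) = Dec c}
      - measure_pmf.prob D {S'. copy S' s = Dec c}\<bar> \<le> \<epsilon>" if "s \<in> bits k" for s
    using order_trans[OF abs_prob_diff_le_tv_dist[where A = "{Dec c}"] D[OF that]]
    by (simp add: vimage_def)
  have "measure_pmf.prob (encode r Enc s1) {x. Dec (f x) = Dec c} = 1"
    using p1 by (subst measure_pmf.prob_eq_1) (auto simp: AE_measure_pmf_iff f_def)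
  moreover have "{x. Dec (f x) = Dec c} = {x. take m x \<in> T}"
    using ne by (auto simp: f_def)
  \<comment> \<open>For \<open>s1\<close> the outcome \<open>Same\<close> yields
    \<open>Some s1\<close>, which differs from \<open>Dec c\<close>; every other outcome ignores the
    message.\<close>
  moreover have "measure_pmf.prob D {S'. copy S' s1 = Dec c} \<le> measure_pmf.prob D {S'. copy S' s0 = Dec c}"
  proof (intro measure_pmf.finite_measure_mono)
    show "{S'. copy S' s1 = Dec c} \<subseteq> {S'. copy S' s0 = Dec c}"
    proof
      fix S' assume "S' \<in> {S'. copy S' s1 = Dec c}"
      then show "S' \<in> {S'. copy S' s0 = Dec c}"
        using s1(2) by (cases S') auto
    qed
  qed simp
  ultimately show False
    using close[OF s0] close[OF s1(1)] p0 \<open>\<epsilon> \<le> 1 / 4\<close> by simp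
qed

text \<open>Provides two target words with a common suffix \<open>y\<close>. If the prefix never
  mattered, the \<open>2 ^ (n - m)\<close> suffixes would have to account for all
  \<open>2 ^ k\<close> messages.\<close>

lemma decoder_depends_on_prefix:
  assumes cs: "coding_scheme n k r Enc Dec" and "m \<le> n" and "n - m < k"
  obtains w w' y where "w \<in> bits m" "w' \<in> bits m" "y \<in> bits (n - m)" "Dec (w @ y) \<noteq> Dec (w' @ y)"
proof (rule ccontr)
  assume "\<not> thesis"
  with that have const: "Dec (w @ y) = Dec (w' @ y)"
    if "w \<in> bits m" "w' \<in> bits m" "y \<in> bits (n - m)" for w w' y
    using that by blast
  define w where "w = replicate m False"
  have "bits k \<subseteq> (\<lambda>y. the (Dec (w @ y))) ` bits (n - m)"
  proof
    fix s assume "s \<in> bits k"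
    then obtain x where x: "x \<in> bits n" "Dec x = Some s"
      using codeword_exists[OF cs] by blast
    then have "Dec (w @ drop m x) = Dec (take m x @ drop m x)"
      using \<open>m \<le> n\<close> by (intro const) (auto simp: w_def bits_def)
    with x have "s = the (Dec (w @ drop m x))"
      by simp
    moreover have "drop m x \<in> bits (n - m)"
      using x by (simp add: bits_def)
    ultimately show "s \<in> (\<lambda>y. the (Dec (w @ y))) ` bits (n - m)"
      by blast
  qed
  then have "card (bits k) \<le> card (bits (n - m))"
    by (intro surj_card_le) auto
  then show False
    using \<open>n - m < k\<close> by (simp add: card_bits)
qed

lemma split_state_rate_bound:
  assumes cs: "coding_scheme n k r Enc Dec" and nm: "non_malleable k r Enc Dec (split_state n) \<epsilon>"
    and "\<epsilon> \<le> 1 / 4"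
  shows "k < n - n div 2 + 3"
proof (rule ccontr)
  assume "\<not> ?thesis"
  then have k: "n - n div 2 + 3 \<le> k" "n - n div 2 < k" and le: "n div 2 \<le> n"
    by auto
  obtain w w' y where w: "w \<in> bits (n div 2)" "w' \<in> bits (n div 2)" "y \<in> bits (n - n div 2)"
    and ne: "Dec (w @ y) \<noteq> Dec (w' @ y)"
    using decoder_depends_on_prefix[OF cs le k(2)] by blast
  have "(\<lambda>x. if take (n div 2) x \<in> T then w @ y else w' @ y) \<in> split_state n" for T
    \<comment> \<open>The left function performs the test on the prefix; the right one is constantly
      \<open>y\<close>.\<close>
    unfolding split_state_def mem_Collect_eq
    using w by (intro bexI[of _ "\<lambda>u. if u \<in> T then w else w'"] bexI[of _ "\<lambda>_. y"]) auto
  with not_non_malleable_prefix_tampering[OF cs le k(1) ne _ \<open>\<epsilon> \<le> 1 / 4\<close>] nm show False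
    by blast
qed

lemma local_tampering_rate_bound:
  assumes cs: "coding_scheme n k r Enc Dec" and nm: "non_malleable k r Enc Dec (local_tampering \<delta> n) \<epsilon>"
    and "\<epsilon> \<le> 1 / 4" and m: "m \<le> n" "int m \<le> \<lfloor>\<delta> * real n\<rfloor>"
  shows "k < n - m + 3"
proof (rule ccontr)
  assume "\<not> ?thesis"
  then have k: "n - m + 3 \<le> k"
    by auto
  \<comment> \<open>These messages differ because \<open>k\<close> is at least 3.\<close>
  define s s' where "s = replicate k False" and "s' = replicate k True"
  have "s \<in> bits k" "s' \<in> bits k" "s \<noteq> s'"
    using k by (auto simp: s_def s'_def bits_def)
  moreover obtain c where c: "c \<in> bits n" "Dec c = Some s"
    using codeword_exists[OF cs \<open>s \<in> bits k\<close>] .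
  moreover obtain c' where c': "c' \<in> bits n" "Dec c' = Some s'"
    using codeword_exists[OF cs \<open>s' \<in> bits k\<close>] .
  ultimately have ne: "Dec c \<noteq> Dec c'"
    by simp
  have "(\<lambda>x. if take m x \<in> T then c else c') \<in> local_tampering \<delta> n" for T
    unfolding local_tampering_def mem_Collect_eq
  proof (intro conjI allI impI)
    show "(\<lambda>x. if take m x \<in> T then c else c') \<in> bits n \<rightarrow> bits n"
      using c c' by auto
    fix i
    have "depends_only_on n (\<lambda>x. (if take m x \<in> T then c else c') ! i) {..<m}"
      unfolding depends_only_on_def
    proof (intro ballI impI)
      fix x y assume "x \<in> bits n" "y \<in> bits n" "\<forall>j\<in>{..<m}. x ! j = y ! j"
      then have "take m x = take m y"
        by (intro nth_equalityI) (auto simp: bits_def)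
      then show "(if take m x \<in> T then c else c') ! i = (if take m y \<in> T then c else c') ! i"
        by simp
    qed
    then show "\<exists>J\<subseteq>{..<n}. int (card J) \<le> \<lfloor>\<delta> * real n\<rfloor> \<and>
        depends_only_on n (\<lambda>x. (if take m x \<in> T then c else c') ! i) J"
      using m by (intro exI[of _ "{..<m}"]) auto
  qed
  with not_non_malleable_prefix_tampering[OF cs m(1) k ne _ \<open>\<epsilon> \<le> 1 / 4\<close>] nm show False
    by blast
qed

theorem corollary5p4:
  fixes \<delta> \<gamma> :: real
  assumes "0 < \<delta>" and "\<delta> < 1" and "0 < \<gamma>"
  shows "\<exists>\<epsilon>0>0. \<forall>\<^sub>F n in sequentially. \<forall>\<epsilon>\<le>\<epsilon>0.
    (\<forall>k r Enc Dec. coding_scheme n k r Enc Dec \<longrightarrow>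
       non_malleable k r Enc Dec (split_state n) \<epsilon> \<longrightarrow>
       rate n k \<le> 1 / 2 + \<gamma>) \<and>
    (\<forall>k r Enc Dec. coding_scheme n k r Enc Dec \<longrightarrow>
       non_malleable k r Enc Dec (local_tampering \<delta> n) \<epsilon> \<longrightarrow>
       rate n k \<le> 1 - \<delta> + \<gamma>)"
proof (intro exI[of _ "1 / 4"] conjI)
  \<comment> \<open>The additive losses are at most 5/2 in the split-state case and less than 3 in
    the local case, where rounding down \<delta> n costs up to one bit; 4 \<le> \<gamma> n absorbs
    both.\<close>
  have "\<forall>\<^sub>F n in sequentially. 4 / \<gamma> \<le> real n"
    using filterlim_real_sequentially by (simp add: filterlim_at_top)
  then show "\<forall>\<^sub>F n in sequentially. \<forall>\<epsilon>\<le>1 / 4.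
    (\<forall>k r Enc Dec. coding_scheme n k r Enc Dec \<longrightarrow>
       non_malleable k r Enc Dec (split_state n) \<epsilon> \<longrightarrow>
       rate n k \<le> 1 / 2 + \<gamma>) \<and>
    (\<forall>k r Enc Dec. coding_scheme n k r Enc Dec \<longrightarrow>
       non_malleable k r Enc Dec (local_tampering \<delta> n) \<epsilon> \<longrightarrow>
       rate n k \<le> 1 - \<delta> + \<gamma>)"
  proof (eventually_elim, intro allI impI conjI)
    fix n k r :: nat and \<epsilon> :: real and Enc Dec
    assume "4 / \<gamma> \<le> real n" and eps: "\<epsilon> \<le> 1 / 4" and cs: "coding_scheme n k r Enc Dec"
    then have n: "4 \<le> \<gamma> * real n"
      using \<open>0 < \<gamma>\<close> by (simp add: field_simps)
    then have "0 < real n"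
      by (cases n) auto
    {
      assume "non_malleable k r Enc Dec (split_state n) \<epsilon>"
      then have "k < n - n div 2 + 3"
        using split_state_rate_bound[OF cs _ eps] by blast
      then have "2 * k \<le> n + 5"
        by linarith
      then have "real k \<le> (1 / 2 + \<gamma>) * real n"
        using n by (simp add: algebra_simps)
      then show "rate n k \<le> 1 / 2 + \<gamma>"
        using \<open>0 < real n\<close> by (simp add: rate_def field_simps)
    }
    assume nm: "non_malleable k r Enc Dec (local_tampering \<delta> n) \<epsilon>"
    define m where "m = nat \<lfloor>\<delta> * real n\<rfloor>"
    have "0 \<le> \<delta> * real n" "\<delta> * real n \<le> real n"
      using assms by (auto simp: mult_left_le_one_le)
    then have m: "m \<le> n" "int m \<le> \<lfloor>\<delta> * real n\<rfloor>" and "\<delta> * real n < real m + 1"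
      unfolding m_def by linarith+
    moreover have "k < n - m + 3"
      using local_tampering_rate_bound[OF cs nm eps m] .
    ultimately have "real k \<le> (1 - \<delta> + \<gamma>) * real n"
      using n by (simp add: algebra_simps)
    then show "rate n k \<le> 1 - \<delta> + \<gamma>"
      using \<open>0 < real n\<close> by (simp add: rate_def field_simps)
  qed
qed simp

end
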